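(* Consider the networked feedback system described in the context, under the input assumption stated there, and let $d_i(k)=\omega(k,k-i)u(k-i)$ for $i\in\mathcal D$. Then for all integers $k_1,k_2\ge 0$: (1) for $i\in\mathcal D$, $\mathbb E\{d_i(k_1)d_i(k_2)\}=\delta(k_1-k_2)\,\alpha_i^2p_i(1-p_i)\,\mathbb E\{u^2(k_1-i)\}$; (2) for $i_1\ne i_2$ in $\mathcal D$, $\mathbb E\{d_{i_1}(k_1)d_{i_2}(k_2)\}=-\delta(k_1-i_1-k_2+i_2)\,\alpha_{i_1}\alpha_{i_2}p_{i_1}p_{i_2}\,\mathbb E\{u^2(k_1-i_1)\}$.
   Context: Setting: $P$ is a SISO discrete-time LTI plant which is strictly proper (relative degree $\ge1$), $K$ a proper SISO LTI controller. Let $\tau\ge0$ be an integer, $\mathcal D=\{0,\dots,\tau\}$, and $\{\tau_n\}$ an i.i.d. sequence with values in $\mathcal D$, $\Pr\{\tau_n=i\}=p_i$, $\sum_ip_i=1$. With real weights $\alpha_0,\dots,\alpha_\tau$ and Kronecker delta $\delta$, the channel maps $u$ to $u_d(k)=\sum_{i=0}^{\tau}\alpha_i\delta(\tau_{k-i}-i)u(k-i)$. Closed loop: plant input $v-u_d$, plant output $y$, $u=Ky$; signals real, system at rest at $k=0$ (signals vanish for $k<0$). Define $\omega(k,n)=\alpha_{k-n}[\delta(\tau_n-(k-n))-p_{k-n}]$ if $n\le k\le n+\tau$ and $\omega(k,n)=0$ otherwise. Input assumption: $\{\tau_n\}$ is independent of $\{v(k)\}$, and $\{v(k)\}$ is zero-mean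 white noise (independent values) with bounded variances. *)

theory Defs
  imports "HOL-Probability.Probability"
begin

text \<open>Kronecker delta on the integers.\<close>
definition kron :: "int \<Rightarrow> real" where
  "kron j = (if j = 0 then 1 else 0)"

text \<open>Extension of a signal indexed by nat (times k \<ge> 0) to all integer times,
  vanishing for negative times (system at rest).\<close>
definition sig_ext :: "(nat \<Rightarrow> 'w \<Rightarrow> real) \<Rightarrow> int \<Rightarrow> 'w \<Rightarrow> real" where
  "sig_ext s j w = (if j < 0 then 0 else s (nat j) w)"

text \<open>Channel output
  u_d(k) = \<Sum>_{i=0}^{tau} alpha_i \<delta>(tau_{k-i} - i) u(k-i), with u(k-i) = 0 for k < i.\<close>
definition chan_out ::
  "(nat \<Rightarrow> real) \<Rightarrow> nat \<Rightarrow> (nat \<Rightarrow> 'w \<Rightarrow> nat) \<Rightarrow> (nat \<Rightarrow> 'w \<Rightarrow> real) \<Rightarrow> nat \<Rightarrow> 'w \<Rightarrow> real" where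
  "chan_out alpha tau taus u k w =
     (\<Sum>i\<in>{0..tau}. if i \<le> k
        then alpha i * kron (int (taus (k - i) w) - int i) * u (k - i) w else 0)"

text \<open>omega(k,n) = alpha_{k-n} [\<delta>(tau_n - (k-n)) - p_{k-n}] if n \<le> k \<le> n + tau, else 0.\<close>
definition omega_ch ::
  "(nat \<Rightarrow> real) \<Rightarrow> (nat \<Rightarrow> real) \<Rightarrow> nat \<Rightarrow> (nat \<Rightarrow> 'w \<Rightarrow> nat) \<Rightarrow> nat \<Rightarrow> nat \<Rightarrow> 'w \<Rightarrow> real" where
  "omega_ch alpha p tau taus k n w =
     (if n \<le> k \<and> k \<le> n + tau
      then alpha (k - n) * (kron (int (taus n w) - int (k - n)) - p (k - n)) else 0)"

text \<open>d_i(k) = omega(k, k-i) u(k-i), which is 0 when k - i < 0 (u vanishes there).\<close>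
definition d_ch ::
  "(nat \<Rightarrow> real) \<Rightarrow> (nat \<Rightarrow> real) \<Rightarrow> nat \<Rightarrow> (nat \<Rightarrow> 'w \<Rightarrow> nat) \<Rightarrow> (nat \<Rightarrow> 'w \<Rightarrow> real) \<Rightarrow> nat \<Rightarrow> nat \<Rightarrow> 'w \<Rightarrow> real" where
  "d_ch alpha p tau taus u i k w =
     (if i \<le> k then omega_ch alpha p tau taus k (k - i) w * u (k - i) w else 0)"

text \<open>Closed loop, sample path by sample path.  The strictly proper SISO plant P is given by a
  state-space realization (A,B,C) (no feedthrough), the proper SISO controller K by (Ak,Bk,Ck,Dk);
  both start at rest (zero state at k = 0).  Plant input is v - u_d, plant output y, u = K y.\<close>
definition closed_loop ::
  "real^'n^'n \<Rightarrow> real^'n \<Rightarrow> real^'n \<Rightarrow> real^'m^'m \<Rightarrow> real^'m \<Rightarrow> real^'m \<Rightarrow> real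
   \<Rightarrow> (nat \<Rightarrow> real) \<Rightarrow> nat \<Rightarrow> (nat \<Rightarrow> 'w \<Rightarrow> nat)
   \<Rightarrow> (nat \<Rightarrow> 'w \<Rightarrow> real) \<Rightarrow> (nat \<Rightarrow> 'w \<Rightarrow> real) \<Rightarrow> (nat \<Rightarrow> 'w \<Rightarrow> real) \<Rightarrow> 'w \<Rightarrow> bool" where
  "closed_loop A B C Ak Bk Ck Dk alpha tau taus v u y w \<longleftrightarrow>
     (\<exists>xp :: nat \<Rightarrow> real^'n. \<exists>xk :: nat \<Rightarrow> real^'m.
        xp 0 = 0 \<and> xk 0 = 0 \<and>
        (\<forall>k. xp (Suc k) = A *v xp k + (v k w - chan_out alpha tau taus u k w) *\<^sub>R B) \<and>
        (\<forall>k. y k w = C \<bullet> xp k) \<and>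
        (\<forall>k. xk (Suc k) = Ak *v xk k + y k w *\<^sub>R Bk) \<and>
        (\<forall>k. u k w = Ck \<bullet> xk k + Dk * y k w))"

end

theory Submission
  imports Defs
begin

(* Write d_i(k) = alpha_i c_i(tau_(k-i)) u(k-i) with the centred indicator c_i(j) = delta(j - i) - p_i,
   so that E c_i(tau_n) = 0 and E c_a(tau_n) c_b(tau_n) = delta(a - b) p_a - p_a p_b.
   Let F_n be the sigma-algebra generated by tau_0, ..., tau_(n-1) and the whole input v. As the delays
   are i.i.d. and independent of v, tau_n is independent of F_n. The loop is causal: tau_n first enters
   the plant state at time n + 1, so u(n) is F_n-measurable; and |u(n)| is at most a constant times
   |v(0)| + ... + |v(n-1)|, so u(n) is square integrable. Hence for n1 < n2 the factor c_b(tau_n2) splits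
   off from E[c_a(tau_n1) u(n1) c_b(tau_n2) u(n2)] and kills it, while for n1 = n2 this expectation is
   E[c_a(tau_n) c_b(tau_n)] E[u(n)^2]. *)

lemma (in prob_space) indep_set_Int_right:
  assumes AB: "indep_set A B" and SC: "indep_set S C"
    and "A \<subseteq> S" "B \<subseteq> S" and S: "Int_stable S"
  shows "indep_set A {b \<inter> c | b c. b \<in> B \<and> c \<in> C}"
proof (rule indep_setI)
  show "A \<subseteq> events"
    using indep_setD_ev1[OF AB] .
  show "{b \<inter> c | b c. b \<in> B \<and> c \<in> C} \<subseteq> events"
    using indep_setD_ev2[OF AB] indep_setD_ev2[OF SC] by blast
  fix a x assume a: "a \<in> A" and "x \<in> {b \<inter> c | b c. b \<in> B \<and> c \<in> C}"
  then obtain b c where x: "x = b \<inter> c" and b: "b \<in> B" and c: "c \<in> C"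
    by blast
  have "a \<inter> b \<in> S" "b \<in> S"
    using a b assms(3,4) Int_stableD[OF S] by blast+
  have "prob (a \<inter> x) = prob (a \<inter> b) * prob c"
    using indep_setD[OF SC \<open>a \<inter> b \<in> S\<close> c] by (simp add: x Int_assoc)
  also have "\<dots> = prob a * (prob b * prob c)"
    using indep_setD[OF AB a b] by simp
  also have "prob b * prob c = prob x"
    using indep_setD[OF SC \<open>b \<in> S\<close> c] by (simp add: x)
  finally show "prob (a \<inter> x) = prob a * prob x" .
qed

lemma (in prob_space) integral_mult_indep_subalgebra:
  fixes g :: "'b \<Rightarrow> real" and Y :: "'a \<Rightarrow> real"
  assumes F: "subalgebra M F"
    and indep: "indep_set (sigma_sets (space M) {X -` A \<inter> space M | A. A \<in> sets N}) (sets F)"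
    and X: "X \<in> measurable M N" and g: "g \<in> borel_measurable N"
    and Y: "Y \<in> borel_measurable F"
    and "integrable M (\<lambda>w. g (X w))" "integrable M Y"
  shows "expectation (\<lambda>w. g (X w) * Y w) = expectation (\<lambda>w. g (X w)) * expectation Y"
proof (rule indep_var_lebesgue_integral)
  have gX: "sigma_sets (space M) {(\<lambda>w. g (X w)) -` A \<inter> space M | A. A \<in> sets borel}
      \<subseteq> sigma_sets (space M) {X -` A \<inter> space M | A. A \<in> sets N}"
  proof (rule sigma_sets_mono')
    show "{(\<lambda>w. g (X w)) -` A \<inter> space M | A. A \<in> sets borel} \<subseteq> {X -` A \<inter> space M | A. A \<in> sets N}"
    proof safe
      fix A :: "real set" assume "A \<in> sets borel"
      then have "(\<lambda>w. g (X w)) -` A \<inter> space M = X -` (g -` A \<inter> space N) \<inter> space M"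
        "g -` A \<inter> space N \<in> sets N"
        using measurable_space[OF X] measurable_sets[OF g] by auto
      then show "\<exists>B. (\<lambda>w. g (X w)) -` A \<inter> space M = X -` B \<inter> space M \<and> B \<in> sets N"
        by blast
    qed
  qed
  have YF: "sigma_sets (space M) {Y -` A \<inter> space M | A. A \<in> sets borel} \<subseteq> sets F"
  proof -
    interpret F: sigma_algebra "space M" "sets F"
      using F sets.sigma_algebra_axioms[of F] by (simp add: subalgebra_def)
    show ?thesis
      using measurable_sets[OF Y] F by (intro F.sigma_sets_subset) (auto simp: subalgebra_def)
  qed
  have "indep_set (sigma_sets (space M) {(\<lambda>w. g (X w)) -` A \<inter> space M | A. A \<in> sets borel})
      (sigma_sets (space M) {Y -` A \<inter> space M | A. A \<in> sets borel})"
    using indep unfolding indep_set_def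
    by (rule indep_sets_mono_sets) (use gX YF in \<open>auto split: bool.split\<close>)
  then show "indep_var borel (\<lambda>w. g (X w)) borel Y"
    using X g measurable_from_subalg[OF F Y] unfolding indep_var_eq by auto
qed fact+

lemma integrable_mult_of_square_integrable:
  fixes f g :: "'a \<Rightarrow> real"
  assumes "f \<in> borel_measurable M" "g \<in> borel_measurable M"
    and "integrable M (\<lambda>w. (f w)\<^sup>2)" "integrable M (\<lambda>w. (g w)\<^sup>2)"
  shows "integrable M (\<lambda>w. f w * g w)"
proof (rule Bochner_Integration.integrable_bound)
  show "integrable M (\<lambda>w. (f w)\<^sup>2 + (g w)\<^sup>2)"
    using assms by simp
  have "\<bar>f w\<bar> * \<bar>g w\<bar> \<le> (f w)\<^sup>2 + (g w)\<^sup>2" for w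
  proof -
    have "2 * (\<bar>f w\<bar> * \<bar>g w\<bar>) \<le> (f w)\<^sup>2 + (g w)\<^sup>2"
      using sum_squares_bound[of "\<bar>f w\<bar>" "\<bar>g w\<bar>"] by (simp add: mult.assoc)
    then show ?thesis
      using mult_nonneg_nonneg[OF abs_ge_zero abs_ge_zero, of "f w" "g w"] by linarith
  qed
  then show "AE w in M. norm (f w * g w) \<le> norm ((f w)\<^sup>2 + (g w)\<^sup>2)"
    by (simp add: abs_mult)
qed (use assms in simp)

lemma (in filtration) measurable_F_mono:
  assumes "f \<in> measurable (F i) N" and "i \<le> j"
  shows "f \<in> measurable (F j) N"
  using assms space_F sets_F_mono
  by (intro measurable_from_subalg[OF _ assms(1)]) (simp add: subalgebra_def)

lemma (in prob_space) expectation_finite_range: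
  fixes Y :: "'a \<Rightarrow> 'b" and g :: "'b \<Rightarrow> real"
  assumes Y: "Y \<in> measurable M (count_space UNIV)"
    and range: "\<And>w. w \<in> space M \<Longrightarrow> Y w \<in> S" and "finite S"
  shows "expectation (\<lambda>w. g (Y w)) = (\<Sum>i\<in>S. g i * prob {w \<in> space M. Y w = i})"
proof -
  define E where "E i = {w \<in> space M. Y w = i}" for i
  have E: "E i \<in> events" for i
    unfolding E_def using Y by measurable
  have "g (Y w) = (\<Sum>i\<in>S. g i * indicator (E i) w)" if "w \<in> space M" for w
    using range[OF that] \<open>finite S\<close> that
    by (simp add: E_def indicator_def if_distrib[of "\<lambda>x. _ * x"] sum.delta' cong: conj_cong)
  then have "expectation (\<lambda>w. g (Y w)) = expectation (\<lambda>w. \<Sum>i\<in>S. g i * indicator (E i) w)"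
    by (rule Bochner_Integration.integral_cong[OF refl])
  also have "\<dots> = (\<Sum>i\<in>S. g i * prob (E i))"
    using E by (subst Bochner_Integration.integral_sum)
      (auto intro!: integrable_mult_right integrable_real_indicator simp: less_top[symmetric])
  finally show ?thesis
    by (simp add: E_def)
qed

lemma (in prob_space) integrable_square_if_abs_le_sum:
  fixes U :: "'a \<Rightarrow> real" and V :: "nat \<Rightarrow> 'a \<Rightarrow> real"
  assumes "U \<in> borel_measurable M" "\<And>l. integrable M (\<lambda>w. (V l w)\<^sup>2)"
    and U_le: "\<And>w. w \<in> space M \<Longrightarrow> \<bar>U w\<bar> \<le> c * (\<Sum>l<k. \<bar>V l w\<bar>)"
  shows "integrable M (\<lambda>w. (U w)\<^sup>2)"
proof (rule Bochner_Integration.integrable_bound)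
  show "integrable M (\<lambda>w. c\<^sup>2 * ((\<Sum>l<k. (V l w)\<^sup>2) * real k))"
    using assms(2) by simp
  show "AE w in M. norm ((U w)\<^sup>2) \<le> norm (c\<^sup>2 * ((\<Sum>l<k. (V l w)\<^sup>2) * real k))"
  proof (rule AE_I2)
    fix w assume "w \<in> space M"
    have "(U w)\<^sup>2 \<le> (c * (\<Sum>l<k. \<bar>V l w\<bar>))\<^sup>2"
      using power_mono[OF U_le[OF \<open>w \<in> space M\<close>] abs_ge_zero, of 2] by simp
    also have "\<dots> \<le> c\<^sup>2 * ((\<Sum>l<k. (V l w)\<^sup>2) * real k)"
      using sum_squared_le_sum_of_squares[of "\<lambda>l. \<bar>V l w\<bar>" "{..<k}"]
      by (simp add: power_mult_distrib mult_left_mono)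
    finally show "norm ((U w)\<^sup>2) \<le> norm (c\<^sup>2 * ((\<Sum>l<k. (V l w)\<^sup>2) * real k))"
      by (simp add: sum_nonneg)
  qed
qed (use assms(1) in simp)

section \<open>Past filtration of a process independent of exogenous events\<close>

locale indep_process_events = prob_space M for M :: "'a measure" +
  fixes N :: "'b measure" and X :: "nat \<Rightarrow> 'a \<Rightarrow> 'b" and E :: "'a set set"
  assumes indep_process: "indep_vars (\<lambda>_. N) X UNIV"
    and indep_events: "indep_set (sigma_sets (space M) (\<Union>n. {X n -` A \<inter> space M | A. A \<in> sets N})) E"
    and sigma_algebra_events: "sigma_algebra (space M) E"
begin

definition past_events :: "nat \<Rightarrow> 'a set set" where
  "past_events n = sigma_sets (space M) (\<Union>j<n. {X j -` A \<inter> space M | A. A \<in> sets N})"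

definition past_filtration :: "nat \<Rightarrow> 'a measure" where
  "past_filtration n = sigma (space M) {b \<inter> c | b c. b \<in> past_events n \<and> c \<in> E}"

lemma measurable_X: "X n \<in> measurable M N"
  using indep_process by (simp add: indep_vars_def2)

lemma E_subset_events: "E \<subseteq> events"
  using indep_setD_ev2[OF indep_events] .

lemma past_events_subset: "past_events n \<subseteq> events"
  unfolding past_events_def using measurable_sets[OF measurable_X] by (intro sets.sigma_sets_subset) auto

lemma space_in_past_events: "space M \<in> past_events n"
  unfolding past_events_def by (rule sigma_sets_top)

lemma past_filtration_generators_subset: "{b \<inter> c | b c. b \<in> past_events n \<and> c \<in> E} \<subseteq> events"
  using past_events_subset E_subset_events by blast

lemma space_past_filtration [simp]: "space (past_filtration n) = space M"
  using past_filtration_generators_subset sets.sets_into_space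
  unfolding past_filtration_def by (intro space_measure_of) blast

lemma sets_past_filtration:
  "sets (past_filtration n) = sigma_sets (space M) {b \<inter> c | b c. b \<in> past_events n \<and> c \<in> E}"
  using past_filtration_generators_subset sets.sets_into_space
  unfolding past_filtration_def by (intro sets_measure_of) blast

lemma subalgebra_past_filtration: "subalgebra M (past_filtration n)"
  unfolding subalgebra_def sets_past_filtration
  using past_filtration_generators_subset by (simp add: sets.sigma_sets_subset)

lemma past_filtration_mono:
  assumes "j \<le> k" shows "sets (past_filtration j) \<subseteq> sets (past_filtration k)"
proof -
  have "past_events j \<subseteq> past_events k"
    unfolding past_events_def using assms by (intro sigma_sets_subseteq UN_mono) auto
  then show ?thesis
    unfolding sets_past_filtration by (intro sigma_sets_subseteq) blast
qed

sublocale filtration "space M" past_filtration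
  by unfold_locales (simp_all add: past_filtration_mono)

sublocale E: sigma_algebra "space M" E
  by (rule sigma_algebra_events)

lemma Int_in_past_filtration:
  assumes "b \<in> past_events n" and "c \<in> E"
  shows "b \<inter> c \<in> sets (past_filtration n)"
  unfolding sets_past_filtration using assms by (intro sigma_sets.Basic) blast

lemma measurable_past_filtration_X:
  assumes "j < n" shows "X j \<in> measurable (past_filtration n) N"
proof (rule measurableI)
  show "X j w \<in> space N" if "w \<in> space (past_filtration n)" for w
    using that measurable_space[OF measurable_X] by simp
  fix A assume "A \<in> sets N"
  then have "X j -` A \<inter> space M \<in> past_events n"
    unfolding past_events_def using assms by (intro sigma_sets.Basic) blast
  from Int_in_past_filtration[OF this E.top]
  show "X j -` A \<inter> space (past_filtration n) \<in> sets (past_filtration n)"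
    by simp
qed

lemma E_subset_past_filtration: "E \<subseteq> sets (past_filtration n)"
proof
  fix c assume "c \<in> E"
  from Int_in_past_filtration[OF space_in_past_events this] E.sets_into_space[OF this]
  show "c \<in> sets (past_filtration n)"
    by (simp add: Int_absorb1)
qed

lemma measurable_past_filtration_if_E:
  assumes "Y \<in> measurable M K" and "\<And>A. A \<in> sets K \<Longrightarrow> Y -` A \<inter> space M \<in> E"
  shows "Y \<in> measurable (past_filtration n) K"
proof (rule measurableI)
  show "Y w \<in> space K" if "w \<in> space (past_filtration n)" for w
    using that measurable_space[OF assms(1)] by simp
  show "Y -` A \<inter> space (past_filtration n) \<in> sets (past_filtration n)" if "A \<in> sets K" for A
    using subsetD[OF E_subset_past_filtration assms(2)[OF that]] by simp
qed

lemma indep_set_past_filtration: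
  "indep_set (sigma_sets (space M) {X n -` A \<inter> space M | A. A \<in> sets N}) (sets (past_filtration n))"
proof -
  define T where "T i = {X i -` A \<inter> space M | A. A \<in> sets N}" for i
  define P where "P = past_events n"
  have T_Pow: "T i \<subseteq> Pow (space M)" for i
    by (auto simp: T_def)
  have UN_T_Pow: "(\<Union>i\<in>I. T i) \<subseteq> Pow (space M)" for I
    using T_Pow by blast
  interpret P: sigma_algebra "space M" P
    unfolding P_def past_events_def T_def[symmetric] by (rule sigma_algebra_sigma_sets[OF UN_T_Pow])
  have "indep_sets (\<lambda>b. sigma_sets (space M) (\<Union>i\<in>case_bool {n} {..<n} b. T i)) UNIV"
  proof (rule indep_sets_collect_sigma)
    show "indep_sets T (\<Union>b. case_bool {n} {..<n} b)"
      using indep_process unfolding indep_vars_def2 T_def by (auto intro: indep_sets_mono_index)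
    show "Int_stable (T i)" for i
    proof (rule Int_stableI)
      fix a b assume "a \<in> T i" "b \<in> T i"
      then obtain A B where "a = X i -` A \<inter> space M" "b = X i -` B \<inter> space M" "A \<in> sets N" "B \<in> sets N"
        by (auto simp: T_def)
      then have "a \<inter> b = X i -` (A \<inter> B) \<inter> space M" "A \<inter> B \<in> sets N"
        by auto
      then show "a \<inter> b \<in> T i"
        unfolding T_def by blast
    qed
    show "disjoint_family_on (case_bool {n} {..<n}) UNIV"
      by (auto simp: disjoint_family_on_def split: bool.split)
  qed
  then have "indep_set (sigma_sets (space M) (T n)) P"
    unfolding indep_set_def P_def past_events_def T_def[symmetric]
    by (rule indep_sets_mono_sets) (simp split: bool.split)
  moreover have "indep_set (sigma_sets (space M) (\<Union>i. T i)) E"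
    using indep_events by (simp add: T_def)
  moreover have "sigma_sets (space M) (T n) \<subseteq> sigma_sets (space M) (\<Union>i. T i)"
    "P \<subseteq> sigma_sets (space M) (\<Union>i. T i)"
    unfolding P_def past_events_def T_def[symmetric] by (auto intro!: sigma_sets_mono')
  moreover have "Int_stable (sigma_sets (space M) (\<Union>i. T i))"
    by (rule algebra.Int_stable[OF sigma_algebra.axioms(1)[OF sigma_algebra_sigma_sets[OF UN_T_Pow]]])
  ultimately have "indep_set (sigma_sets (space M) (T n)) {b \<inter> c | b c. b \<in> P \<and> c \<in> E}"
    by (rule indep_set_Int_right)
  moreover have "Int_stable (sigma_sets (space M) (T n))"
    by (rule algebra.Int_stable[OF sigma_algebra.axioms(1)[OF sigma_algebra_sigma_sets[OF T_Pow]]])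
  moreover have "Int_stable {b \<inter> c | b c. b \<in> P \<and> c \<in> E}"
  proof (rule Int_stableI)
    fix x y assume "x \<in> {b \<inter> c | b c. b \<in> P \<and> c \<in> E}" "y \<in> {b \<inter> c | b c. b \<in> P \<and> c \<in> E}"
    then obtain b c b' c' where "x = b \<inter> c" "y = b' \<inter> c'" "b \<in> P" "b' \<in> P" "c \<in> E" "c' \<in> E"
      by blast
    then have "x \<inter> y = (b \<inter> b') \<inter> (c \<inter> c')" "b \<inter> b' \<in> P" "c \<inter> c' \<in> E"
      by auto
    then show "x \<inter> y \<in> {b \<inter> c | b c. b \<in> P \<and> c \<in> E}"
      by blast
  qed
  ultimately have "indep_set (sigma_sets (space M) (sigma_sets (space M) (T n)))
      (sigma_sets (space M) {b \<inter> c | b c. b \<in> P \<and> c \<in> E})"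
    by (rule indep_set_sigma_sets)
  then show ?thesis
    unfolding sigma_sets_sigma_sets_eq[OF T_Pow] sets_past_filtration by (simp only: T_def P_def)
qed

lemma integral_mult_past_filtration:
  fixes g :: "'b \<Rightarrow> real" and Y :: "'a \<Rightarrow> real"
  assumes "g \<in> borel_measurable N" "Y \<in> borel_measurable (past_filtration n)"
    and "integrable M (\<lambda>w. g (X n w))" "integrable M Y"
  shows "expectation (\<lambda>w. g (X n w) * Y w) = expectation (\<lambda>w. g (X n w)) * expectation Y"
  using subalgebra_past_filtration indep_set_past_filtration measurable_X assms
  by (rule integral_mult_indep_subalgebra)

lemma expectation_mult_later_innovation:
  fixes f g :: "'b \<Rightarrow> real" and U :: "nat \<Rightarrow> 'a \<Rightarrow> real"
  assumes "n1 < n2"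
    and U_adapted: "\<And>n. U n \<in> borel_measurable (past_filtration n)"
    and U_sq: "\<And>n. integrable M (\<lambda>w. (U n w)\<^sup>2)"
    and f: "f \<in> borel_measurable N" "\<And>x. \<bar>f x\<bar> \<le> c"
    and g: "g \<in> borel_measurable N" "\<And>x. \<bar>g x\<bar> \<le> c"
    and g_centred: "expectation (\<lambda>w. g (X n2 w)) = 0"
  shows "expectation (\<lambda>w. (f (X n1 w) * U n1 w) * (g (X n2 w) * U n2 w)) = 0"
proof -
  define Y where "Y w = f (X n1 w) * (U n1 w * U n2 w)" for w
  have U_M: "U n \<in> borel_measurable M" for n
    using measurable_from_subalg[OF subalgebra_past_filtration U_adapted] .
  have Y_past: "Y \<in> borel_measurable (past_filtration n2)"
    using measurable_past_filtration_X[OF \<open>n1 < n2\<close>] f(1)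
      measurable_F_mono[OF U_adapted less_imp_le[OF \<open>n1 < n2\<close>]] U_adapted[of n2]
    unfolding Y_def by measurable
  moreover have "integrable M Y"
  proof (rule Bochner_Integration.integrable_bound)
    show "integrable M (\<lambda>w. c * (U n1 w * U n2 w))"
      using U_M U_sq by (intro integrable_mult_right integrable_mult_of_square_integrable)
    have "0 \<le> c"
      using order_trans[OF abs_ge_zero f(2)] .
    then show "AE w in M. norm (Y w) \<le> norm (c * (U n1 w * U n2 w))"
      using f(2) by (intro AE_I2) (simp add: Y_def abs_mult mult_right_mono)
  qed (rule measurable_from_subalg[OF subalgebra_past_filtration Y_past])
  moreover have "integrable M (\<lambda>w. g (X n2 w))"
    using g measurable_X by (intro integrable_const_bound[where B = c]) auto
  ultimately have "expectation (\<lambda>w. g (X n2 w) * Y w) = 0"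
    using integral_mult_past_filtration[OF g(1)] g_centred by simp
  then show ?thesis
    by (simp add: Y_def ac_simps)
qed

lemma expectation_innovation_products:
  fixes f g :: "'b \<Rightarrow> real" and U :: "nat \<Rightarrow> 'a \<Rightarrow> real"
  assumes U_adapted: "\<And>n. U n \<in> borel_measurable (past_filtration n)"
    and U_sq: "\<And>n. integrable M (\<lambda>w. (U n w)\<^sup>2)"
    and f: "f \<in> borel_measurable N" "\<And>x. \<bar>f x\<bar> \<le> c"
    and g: "g \<in> borel_measurable N" "\<And>x. \<bar>g x\<bar> \<le> c"
    and centred: "\<And>n. expectation (\<lambda>w. f (X n w)) = 0" "\<And>n. expectation (\<lambda>w. g (X n w)) = 0"
  shows "expectation (\<lambda>w. (f (X n1 w) * U n1 w) * (g (X n2 w) * U n2 w))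
    = (if n1 = n2 then expectation (\<lambda>w. f (X n1 w) * g (X n1 w)) * expectation (\<lambda>w. (U n1 w)\<^sup>2) else 0)"
proof (cases n1 n2 rule: linorder_cases)
  case less
  with expectation_mult_later_innovation[OF less U_adapted U_sq f g centred(2)] show ?thesis
    by simp
next
  case greater
  with expectation_mult_later_innovation[OF greater U_adapted U_sq g f centred(1)] show ?thesis
    by (simp add: ac_simps)
next
  case equal
  have "integrable M (\<lambda>w. f (X n1 w) * g (X n1 w))"
    using f g measurable_X
    by (intro integrable_const_bound[where B = "c * c"])
       (auto simp: abs_mult intro!: mult_mono order_trans[OF abs_ge_zero f(2)])
  moreover have "(\<lambda>w. (U n1 w)\<^sup>2) \<in> borel_measurable (past_filtration n1)"
    using U_adapted by measurable
  ultimately have "expectation (\<lambda>w. (f (X n1 w) * g (X n1 w)) * (U n1 w)\<^sup>2)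
      = expectation (\<lambda>w. f (X n1 w) * g (X n1 w)) * expectation (\<lambda>w. (U n1 w)\<^sup>2)"
    using f(1) g(1) U_sq by (intro integral_mult_past_filtration[where g = "\<lambda>x. f x * g x"]) auto
  with equal show ?thesis
    by (simp add: power2_eq_square ac_simps)
qed

end

section \<open>Centred delay indicators\<close>

(* omega(k, k - i) = alpha_i * centred_indicator p i (tau_(k-i)) *)
definition centred_indicator :: "(nat \<Rightarrow> real) \<Rightarrow> nat \<Rightarrow> nat \<Rightarrow> real" where
  "centred_indicator p i j = kron (int j - int i) - p i"

lemma abs_centred_indicator_le: "\<bar>centred_indicator p i j\<bar> \<le> 1 + \<bar>p i\<bar>"
  by (auto simp: centred_indicator_def kron_def abs_if)

lemma sum_kron_mult:
  assumes "finite S" "i \<in> S"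
  shows "(\<Sum>j\<in>S. kron (int j - int i) * f j) = f i"
  using assms by (simp add: kron_def if_distrib[of "\<lambda>x. x * _"] sum.delta' cong: if_cong)

lemma sum_centred_indicator:
  assumes "finite S" "i \<in> S" "sum p S = 1"
  shows "(\<Sum>j\<in>S. centred_indicator p i j * p j) = 0"
  using assms sum_kron_mult[OF assms(1,2), of p]
  by (simp add: centred_indicator_def left_diff_distrib sum_subtractf flip: sum_distrib_left)

lemma sum_centred_indicator_mult:
  assumes "finite S" "a \<in> S" "b \<in> S" "sum p S = 1"
  shows "(\<Sum>j\<in>S. centred_indicator p a j * centred_indicator p b j * p j)
    = kron (int a - int b) * p a - p a * p b"
proof -
  have "(\<Sum>j\<in>S. centred_indicator p a j * centred_indicator p b j * p j)
      = (\<Sum>j\<in>S. kron (int j - int a) * (kron (int j - int b) * p j))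
        - p b * (\<Sum>j\<in>S. kron (int j - int a) * p j)
        - p a * (\<Sum>j\<in>S. kron (int j - int b) * p j) + p a * p b * sum p S"
    by (simp add: centred_indicator_def sum_distrib_left sum.distrib[symmetric]
        sum_subtractf[symmetric] algebra_simps)
  also have "\<dots> = kron (int a - int b) * p a - p a * p b"
    using assms sum_kron_mult[OF assms(1,2)] sum_kron_mult[OF assms(1,3)] by simp
  finally show ?thesis .
qed

lemma d_ch_eq_centred_indicator:
  assumes "i \<le> tau"
  shows "d_ch alpha p tau taus u i k w
    = (if i \<le> k then alpha i * (centred_indicator p i (taus (k - i) w) * u (k - i) w) else 0)"
  using assms by (auto simp: d_ch_def omega_ch_def centred_indicator_def)

lemma sig_ext_diff: "sig_ext u (int k - int i) = (if i \<le> k then u (k - i) else (\<lambda>w. 0))"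
  by (auto simp: sig_ext_def fun_eq_iff nat_diff_distrib)

locale delay_channel = indep_process_events M "count_space UNIV" taus E
  for M :: "'a measure" and taus :: "nat \<Rightarrow> 'a \<Rightarrow> nat" and E +
  fixes tau :: nat and p :: "nat \<Rightarrow> real" and u :: "nat \<Rightarrow> 'a \<Rightarrow> real"
  assumes taus_le: "\<And>n w. w \<in> space M \<Longrightarrow> taus n w \<le> tau"
    and prob_taus_eq: "\<And>n i. i \<le> tau \<Longrightarrow> prob {w \<in> space M. taus n w = i} = p i"
    and sum_p: "sum p {0..tau} = 1"
    and u_adapted: "\<And>n. u n \<in> borel_measurable (past_filtration n)"
    and u_square_integrable: "\<And>n. integrable M (\<lambda>w. (u n w)\<^sup>2)"
begin

lemma expectation_fun_taus: "expectation (\<lambda>w. g (taus n w)) = (\<Sum>j\<in>{0..tau}. g j * p j)"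
  using measurable_X taus_le prob_taus_eq by (subst expectation_finite_range[where S = "{0..tau}"]) auto

lemma expectation_centred_indicator_products:
  assumes "a \<le> tau" "b \<le> tau"
  shows "expectation (\<lambda>w. (centred_indicator p a (taus n1 w) * u n1 w)
        * (centred_indicator p b (taus n2 w) * u n2 w))
      = (if n1 = n2 then (kron (int a - int b) * p a - p a * p b) * expectation (\<lambda>w. (u n1 w)\<^sup>2) else 0)"
proof -
  have bound: "\<bar>centred_indicator p a x\<bar> \<le> 1 + \<bar>p a\<bar> + \<bar>p b\<bar>"
    "\<bar>centred_indicator p b x\<bar> \<le> 1 + \<bar>p a\<bar> + \<bar>p b\<bar>" for x
    using abs_centred_indicator_le[of p a x] abs_centred_indicator_le[of p b x] by linarith+
  have "expectation (\<lambda>w. centred_indicator p i (taus n w)) = 0" if "i \<le> tau" for i n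
    using that sum_p by (simp add: expectation_fun_taus sum_centred_indicator)
  moreover have "expectation (\<lambda>w. centred_indicator p a (taus n w) * centred_indicator p b (taus n w))
      = kron (int a - int b) * p a - p a * p b" for n
    using assms sum_p expectation_fun_taus[of "\<lambda>j. centred_indicator p a j * centred_indicator p b j" n]
    by (simp add: sum_centred_indicator_mult)
  ultimately show ?thesis
    using expectation_innovation_products[OF u_adapted u_square_integrable,
        of "centred_indicator p a" "1 + \<bar>p a\<bar> + \<bar>p b\<bar>" "centred_indicator p b" n1 n2] bound assms
    by simp
qed

lemma expectation_d_ch_mult:
  assumes "i1 \<le> tau" "i2 \<le> tau"
  shows "expectation (\<lambda>w. d_ch alpha p tau taus u i1 k1 w * d_ch alpha p tau taus u i2 k2 w)
    = (if i1 \<le> k1 \<and> i2 \<le> k2 \<and> k1 - i1 = k2 - i2 then alpha i1 * alpha i2 *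
         (kron (int i1 - int i2) * p i1 - p i1 * p i2) * expectation (\<lambda>w. (u (k1 - i1) w)\<^sup>2) else 0)"
proof (cases "i1 \<le> k1 \<and> i2 \<le> k2")
  case True
  with assms have "(\<lambda>w. d_ch alpha p tau taus u i1 k1 w * d_ch alpha p tau taus u i2 k2 w)
    = (\<lambda>w. alpha i1 * alpha i2 * ((centred_indicator p i1 (taus (k1 - i1) w) * u (k1 - i1) w)
        * (centred_indicator p i2 (taus (k2 - i2) w) * u (k2 - i2) w)))"
    by (simp add: d_ch_eq_centred_indicator fun_eq_iff)
  then show ?thesis
    using expectation_centred_indicator_products[OF assms, of "k1 - i1" "k2 - i2"] True by simp
qed (use assms in \<open>auto simp: d_ch_eq_centred_indicator\<close>)

end

section \<open>Causality and growth of the sampled closed loop\<close>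

lemma discrete_gronwall_bound:
  fixes z a :: "nat \<Rightarrow> real"
  assumes "z 0 = 0" "0 \<le> K" "0 \<le> b" "\<And>k. 0 \<le> a k"
    and step: "\<And>k m. (\<And>j. j \<le> k \<Longrightarrow> z j \<le> m) \<Longrightarrow> z (Suc k) \<le> K * m + b * a k"
  shows "j \<le> k \<Longrightarrow> z j \<le> b * (1 + K) ^ k * (\<Sum>l<k. a l)"
proof (induction k arbitrary: j)
  case 0
  then show ?case
    using assms(1) by simp
next
  case (Suc k)
  define m where "m = b * (1 + K) ^ k * (\<Sum>l<k. a l)"
  have "0 \<le> (\<Sum>l<k. a l)"
    using assms(4) by (simp add: sum_nonneg)
  have "0 \<le> (1 + K) ^ k" "(1 + K) ^ k \<le> (1 + K) ^ Suc k" "1 \<le> (1 + K) ^ Suc k"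
    using assms(2) by (intro zero_le_power power_increasing one_le_power; simp)+
  have m_le: "m \<le> b * (1 + K) ^ Suc k * (\<Sum>l<Suc k. a l)"
    unfolding m_def using assms(3,4) \<open>0 \<le> (\<Sum>l<k. a l)\<close> \<open>0 \<le> (1 + K) ^ k\<close>
      \<open>(1 + K) ^ k \<le> (1 + K) ^ Suc k\<close>
    by (intro mult_mono mult_left_mono) (simp_all del: power_Suc)
  show ?case
  proof (cases "j \<le> k")
    case True
    with Suc.IH m_le show ?thesis
      unfolding m_def by (meson order_trans)
  next
    case False
    with Suc.prems have "j = Suc k"
      by simp
    have "z (Suc k) \<le> K * m + b * a k"
      using Suc.IH by (intro step) (simp add: m_def)
    also have "K * m \<le> b * (1 + K) ^ Suc k * (\<Sum>l<k. a l)"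
      unfolding m_def using assms(2,3) \<open>0 \<le> (\<Sum>l<k. a l)\<close>
      by (simp add: mult_left_mono mult_right_mono algebra_simps)
    also have "b * a k \<le> b * (1 + K) ^ Suc k * a k"
      using mult_left_mono[OF \<open>1 \<le> (1 + K) ^ Suc k\<close>, of "b * a k"] assms(3,4)
      by (simp add: ac_simps)
    finally show ?thesis
      by (simp add: \<open>j = Suc k\<close> algebra_simps)
  qed
qed

lemma abs_chan_out_le:
  assumes "\<And>i. i \<le> k \<Longrightarrow> \<bar>u (k - i) w\<bar> \<le> b" and "0 \<le> b"
  shows "\<bar>chan_out alpha tau taus u k w\<bar> \<le> (\<Sum>i\<in>{0..tau}. \<bar>alpha i\<bar>) * b"
  unfolding chan_out_def sum_distrib_right
proof (rule order_trans[OF sum_abs sum_mono])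
  fix i
  have "\<bar>kron (int (taus (k - i) w) - int i)\<bar> * \<bar>u (k - i) w\<bar> \<le> 1 * b" if "i \<le> k"
    using assms that by (intro mult_mono) (simp_all add: kron_def)
  then show "\<bar>if i \<le> k then alpha i * kron (int (taus (k - i) w) - int i) * u (k - i) w else 0\<bar>
      \<le> \<bar>alpha i\<bar> * b"
    using assms(2) by (auto simp: abs_mult mult.assoc intro: mult_left_mono)
qed

lemma borel_measurable_matrix_vector_mult [measurable (raw)]:
  fixes A :: "real^'n^'m"
  assumes "f \<in> borel_measurable M"
  shows "(\<lambda>w. A *v f w) \<in> borel_measurable M"
  by (rule borel_measurable_continuous_on[OF matrix_vector_mult_linear_continuous_on assms])

(* State trajectories of the plant and controller realisations along each sample path in \<Omega>,
   with the plant output y k = C \<bullet> xp w k substituted. *)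
locale sampled_closed_loop =
  fixes \<Omega> :: "'w set"
    and A :: "real^'n^'n" and B C :: "real^'n"
    and Ak :: "real^'m^'m" and Bk Ck :: "real^'m" and Dk :: real
    and alpha :: "nat \<Rightarrow> real" and tau :: nat and taus :: "nat \<Rightarrow> 'w \<Rightarrow> nat"
    and v u :: "nat \<Rightarrow> 'w \<Rightarrow> real"
    and xp :: "'w \<Rightarrow> nat \<Rightarrow> real^'n" and xk :: "'w \<Rightarrow> nat \<Rightarrow> real^'m"
  assumes xp_0: "w \<in> \<Omega> \<Longrightarrow> xp w 0 = 0"
    and xk_0: "w \<in> \<Omega> \<Longrightarrow> xk w 0 = 0"
    and xp_Suc: "w \<in> \<Omega> \<Longrightarrow> xp w (Suc k) = A *v xp w k + (v k w - chan_out alpha tau taus u k w) *\<^sub>R B"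
    and xk_Suc: "w \<in> \<Omega> \<Longrightarrow> xk w (Suc k) = Ak *v xk w k + (C \<bullet> xp w k) *\<^sub>R Bk"
    and u_eq: "w \<in> \<Omega> \<Longrightarrow> u k w = Ck \<bullet> xk w k + Dk * (C \<bullet> xp w k)"

lemma closed_loop_imp_sampled_closed_loop:
  fixes A :: "real^'n^'n" and Ak :: "real^'m^'m"
  assumes "\<And>w. w \<in> \<Omega> \<Longrightarrow> closed_loop A B C Ak Bk Ck Dk alpha tau taus v u y w"
  shows "\<exists>xp xk. sampled_closed_loop \<Omega> A B C Ak Bk Ck Dk alpha tau taus v u xp xk"
proof -
  have "\<forall>w\<in>\<Omega>. \<exists>xpk :: (nat \<Rightarrow> real^'n) \<times> (nat \<Rightarrow> real^'m).
      fst xpk 0 = 0 \<and> snd xpk 0 = 0 \<and>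
      (\<forall>k. fst xpk (Suc k) = A *v fst xpk k + (v k w - chan_out alpha tau taus u k w) *\<^sub>R B) \<and>
      (\<forall>k. snd xpk (Suc k) = Ak *v snd xpk k + (C \<bullet> fst xpk k) *\<^sub>R Bk) \<and>
      (\<forall>k. u k w = Ck \<bullet> snd xpk k + Dk * (C \<bullet> fst xpk k))" (is "\<forall>w\<in>\<Omega>. \<exists>xpk. ?P w xpk")
  proof
    fix w assume "w \<in> \<Omega>"
    then obtain xp xk where "xp 0 = 0 \<and> xk 0 = 0 \<and>
        (\<forall>k. xp (Suc k) = A *v xp k + (v k w - chan_out alpha tau taus u k w) *\<^sub>R B) \<and>
        (\<forall>k. y k w = C \<bullet> xp k) \<and>
        (\<forall>k. xk (Suc k) = Ak *v xk k + y k w *\<^sub>R Bk) \<and>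
        (\<forall>k. u k w = Ck \<bullet> xk k + Dk * y k w)"
      using assms unfolding closed_loop_def by blast
    then show "\<exists>xpk. ?P w xpk"
      by (intro exI[of _ "(xp, xk)"]) simp
  qed
  then obtain xpk where "\<forall>w\<in>\<Omega>. ?P w (xpk w)"
    by (rule bchoice[THEN exE]) blast
  then have "sampled_closed_loop \<Omega> A B C Ak Bk Ck Dk alpha tau taus v u
      (\<lambda>w. fst (xpk w)) (\<lambda>w. snd (xpk w))"
    by unfold_locales blast+
  then show ?thesis
    by blast
qed

context sampled_closed_loop
begin

lemma abs_u_le_state:
  assumes "w \<in> \<Omega>"
  shows "\<bar>u k w\<bar> \<le> (norm Ck + \<bar>Dk\<bar> * norm C) * (norm (xp w k) + norm (xk w k))"
proof -
  have "\<bar>u k w\<bar> \<le> \<bar>Ck \<bullet> xk w k\<bar> + \<bar>Dk\<bar> * \<bar>C \<bullet> xp w k\<bar>"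
    using u_eq[OF assms] abs_triangle_ineq[of "Ck \<bullet> xk w k" "Dk * (C \<bullet> xp w k)"]
    by (simp add: abs_mult)
  also have "\<dots> \<le> norm Ck * norm (xk w k) + \<bar>Dk\<bar> * (norm C * norm (xp w k))"
    by (intro add_mono mult_left_mono Cauchy_Schwarz_ineq2) simp_all
  also have "\<dots> \<le> (norm Ck + \<bar>Dk\<bar> * norm C) * (norm (xp w k) + norm (xk w k))"
    by (simp add: algebra_simps)
  finally show ?thesis .
qed

definition loop_gain :: real where
  "loop_gain = onorm ((*v) A) + norm B * (\<Sum>i\<in>{0..tau}. \<bar>alpha i\<bar>) * (norm Ck + \<bar>Dk\<bar> * norm C)
     + onorm ((*v) Ak) + norm Bk * norm C"

lemma loop_gain_nonneg: "0 \<le> loop_gain"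
  unfolding loop_gain_def
  by (intro add_nonneg_nonneg mult_nonneg_nonneg onorm_pos_le matrix_vector_mul_bounded_linear sum_nonneg)
     simp_all

lemma state_norm_Suc_le:
  assumes "w \<in> \<Omega>" and bound: "\<And>j. j \<le> k \<Longrightarrow> norm (xp w j) + norm (xk w j) \<le> m"
  shows "norm (xp w (Suc k)) + norm (xk w (Suc k)) \<le> loop_gain * m + norm B * \<bar>v k w\<bar>"
proof -
  define cu where "cu = norm Ck + \<bar>Dk\<bar> * norm C"
  define al where "al = (\<Sum>i\<in>{0..tau}. \<bar>alpha i\<bar>)"
  have "0 \<le> cu" "0 \<le> al"
    by (simp_all add: cu_def al_def sum_nonneg)
  have "0 \<le> m"
    using bound[of 0] norm_ge_zero[of "xp w 0"] norm_ge_zero[of "xk w 0"] by linarith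
  have xp_le: "norm (xp w k) \<le> m" and xk_le: "norm (xk w k) \<le> m"
    using bound[of k] norm_ge_zero[of "xp w k"] norm_ge_zero[of "xk w k"] by linarith+
  have "\<bar>u (k - i) w\<bar> \<le> cu * m" for i
    using abs_u_le_state[OF assms(1), of "k - i"] bound[of "k - i"] \<open>0 \<le> cu\<close>
    unfolding cu_def by (meson diff_le_self mult_left_mono order_trans)
  then have chan_le: "\<bar>chan_out alpha tau taus u k w\<bar> \<le> al * (cu * m)"
    unfolding al_def using \<open>0 \<le> cu\<close> \<open>0 \<le> m\<close> by (intro abs_chan_out_le) simp_all
  have "norm (xp w (Suc k)) \<le> norm (A *v xp w k) + \<bar>v k w - chan_out alpha tau taus u k w\<bar> * norm B"
    using xp_Suc[OF assms(1)]
      norm_triangle_ineq[of "A *v xp w k" "(v k w - chan_out alpha tau taus u k w) *\<^sub>R B"]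
    by simp
  also have "\<dots> \<le> onorm ((*v) A) * m + (\<bar>v k w\<bar> + al * (cu * m)) * norm B"
    using onorm[OF matrix_vector_mul_bounded_linear, of A "xp w k"] xp_le chan_le
      onorm_pos_le[OF matrix_vector_mul_bounded_linear, of A]
    by (intro add_mono mult_right_mono)
       (auto intro: order_trans mult_left_mono abs_triangle_ineq4[THEN order_trans])
  finally have xp_Suc_le:
    "norm (xp w (Suc k)) \<le> onorm ((*v) A) * m + (\<bar>v k w\<bar> + al * (cu * m)) * norm B" .
  have "norm (xk w (Suc k)) \<le> norm (Ak *v xk w k) + \<bar>C \<bullet> xp w k\<bar> * norm Bk"
    using xk_Suc[OF assms(1)] norm_triangle_ineq[of "Ak *v xk w k" "(C \<bullet> xp w k) *\<^sub>R Bk"]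
    by simp
  also have "\<dots> \<le> onorm ((*v) Ak) * m + norm C * m * norm Bk"
    using onorm[OF matrix_vector_mul_bounded_linear, of Ak "xk w k"] xk_le
      onorm_pos_le[OF matrix_vector_mul_bounded_linear, of Ak]
      Cauchy_Schwarz_ineq2[of C "xp w k"] mult_left_mono[OF xp_le norm_ge_zero[of C]]
    by (intro add_mono mult_right_mono) (auto intro: order_trans mult_left_mono)
  finally have xk_Suc_le: "norm (xk w (Suc k)) \<le> onorm ((*v) Ak) * m + norm C * m * norm Bk" .
  from xp_Suc_le xk_Suc_le show ?thesis
    by (simp add: loop_gain_def cu_def al_def algebra_simps)
qed

lemma abs_u_le_sum_abs_v: "\<exists>c\<ge>0. \<forall>w\<in>\<Omega>. \<bar>u k w\<bar> \<le> c * (\<Sum>l<k. \<bar>v l w\<bar>)"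
proof (intro exI conjI ballI)
  define cu where "cu = norm Ck + \<bar>Dk\<bar> * norm C"
  show "0 \<le> cu * (norm B * (1 + loop_gain) ^ k)"
    using loop_gain_nonneg by (simp add: cu_def)
  fix w assume "w \<in> \<Omega>"
  have "norm (xp w k) + norm (xk w k) \<le> norm B * (1 + loop_gain) ^ k * (\<Sum>l<k. \<bar>v l w\<bar>)"
    using xp_0 xk_0 \<open>w \<in> \<Omega>\<close> loop_gain_nonneg state_norm_Suc_le[OF \<open>w \<in> \<Omega>\<close>]
    by (intro discrete_gronwall_bound[where z = "\<lambda>j. norm (xp w j) + norm (xk w j)"]) simp_all
  then have "cu * (norm (xp w k) + norm (xk w k))
      \<le> cu * (norm B * (1 + loop_gain) ^ k * (\<Sum>l<k. \<bar>v l w\<bar>))"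
    by (rule mult_left_mono) (simp add: cu_def)
  with abs_u_le_state[OF \<open>w \<in> \<Omega>\<close>, of k]
  show "\<bar>u k w\<bar> \<le> cu * (norm B * (1 + loop_gain) ^ k) * (\<Sum>l<k. \<bar>v l w\<bar>)"
    unfolding cu_def by (simp add: mult.assoc)
qed

lemma u_adapted:
  assumes "filtration \<Omega> F"
    and taus_F: "\<And>j k. j < k \<Longrightarrow> taus j \<in> measurable (F k) (count_space UNIV)"
    and v_F: "\<And>j k. v j \<in> borel_measurable (F k)"
  shows "u k \<in> borel_measurable (F k)"
proof -
  interpret filtration \<Omega> F
    by (rule assms(1))
  have u_of_state: "u k \<in> borel_measurable (F n)"
    if "(\<lambda>w. xp w k) \<in> borel_measurable (F n)" "(\<lambda>w. xk w k) \<in> borel_measurable (F n)" for k n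
  proof -
    have "(\<lambda>w. Ck \<bullet> xk w k + Dk * (C \<bullet> xp w k)) \<in> borel_measurable (F n)"
      using that by measurable
    then show ?thesis
      by (simp add: space_F u_eq cong: measurable_cong')
  qed
  have "(\<lambda>w. xp w k) \<in> borel_measurable (F k) \<and> (\<lambda>w. xk w k) \<in> borel_measurable (F k)"
  proof (induction k rule: less_induct)
    case (less k)
    show ?case
    proof (cases k)
      case 0
      then show ?thesis
        by (simp add: space_F xp_0 xk_0 cong: measurable_cong')
    next
      case (Suc k')
      have u_past: "u (k' - i) \<in> borel_measurable (F k)" for i
      proof -
        have "u (k' - i) \<in> borel_measurable (F (k' - i))"
          using less.IH[of "k' - i"] Suc by (intro u_of_state) auto
        then show ?thesis
          by (rule measurable_F_mono) (use Suc in simp)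
      qed
      have taus_past: "taus (k' - i) \<in> measurable (F k) (count_space UNIV)" for i
        using Suc by (intro taus_F) simp
      have "(\<lambda>w. xp w k') \<in> borel_measurable (F k)" "(\<lambda>w. xk w k') \<in> borel_measurable (F k)"
        using less.IH[of k'] Suc by (auto intro: measurable_F_mono)
      moreover have "(\<lambda>w. chan_out alpha tau taus u k' w) \<in> borel_measurable (F k)"
        unfolding chan_out_def using u_past taus_past by measurable
      ultimately have
        "(\<lambda>w. A *v xp w k' + (v k' w - chan_out alpha tau taus u k' w) *\<^sub>R B) \<in> borel_measurable (F k)"
        "(\<lambda>w. Ak *v xk w k' + (C \<bullet> xp w k') *\<^sub>R Bk) \<in> borel_measurable (F k)"
        using v_F by measurable
      then show ?thesis
        using Suc by (simp add: space_F xp_Suc xk_Suc cong: measurable_cong')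
    qed
  qed
  then show ?thesis
    by (blast intro: u_of_state)
qed

end

theorem lemma4:
  fixes M :: "'w measure"
    and A :: "real^'n^'n" and B C :: "real^'n"
    and Ak :: "real^'m^'m" and Bk Ck :: "real^'m" and Dk :: real
    and alpha p :: "nat \<Rightarrow> real" and tau :: nat
    and taus :: "nat \<Rightarrow> 'w \<Rightarrow> nat"
    and v u y :: "nat \<Rightarrow> 'w \<Rightarrow> real"
  assumes "prob_space M"
    \<comment> \<open>i.i.d. delay sequence with values in D = {0..tau} and Pr{tau_n = i} = p_i\<close>
    and "\<And>n. taus n \<in> measurable M (count_space UNIV)"
    and "\<And>n w. w \<in> space M \<Longrightarrow> taus n w \<le> tau"
    and "prob_space.indep_vars M (\<lambda>_. count_space UNIV) taus UNIV"
    and "\<And>n i. i \<le> tau \<Longrightarrow> measure M {w \<in> space M. taus n w = i} = p i"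
    and "(\<Sum>i\<in>{0..tau}. p i) = 1"
    \<comment> \<open>zero-mean white noise input with bounded variances\<close>
    and "\<And>k. v k \<in> borel_measurable M"
    and "prob_space.indep_vars M (\<lambda>_. borel) v UNIV"
    and "\<And>k. integrable M (v k)"
    and "\<And>k. integrable M (\<lambda>w. (v k w)\<^sup>2)"
    and "\<And>k. prob_space.expectation M (v k) = 0"
    and "\<exists>b. \<forall>k. prob_space.variance M (v k) \<le> b"
    \<comment> \<open>delay sequence independent of the input\<close>
    and "prob_space.indep_set M
           (sigma_sets (space M) (\<Union>n. {taus n -` A \<inter> space M | A. A \<in> sets (count_space UNIV)}))
           (sigma_sets (space M) (\<Union>k. {v k -` A \<inter> space M | A. A \<in> sets borel}))"
    \<comment> \<open>closed loop\<close>
    and "\<And>w. w \<in> space M \<Longrightarrow> closed_loop A B C Ak Bk Ck Dk alpha tau taus v u y w"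
  shows "(\<forall>i k1 k2. i \<le> tau \<longrightarrow>
            prob_space.expectation M
              (\<lambda>w. d_ch alpha p tau taus u i k1 w * d_ch alpha p tau taus u i k2 w)
            = kron (int k1 - int k2) * (alpha i)\<^sup>2 * p i * (1 - p i)
              * prob_space.expectation M (\<lambda>w. (sig_ext u (int k1 - int i) w)\<^sup>2))
       \<and> (\<forall>i1 i2 k1 k2. i1 \<le> tau \<longrightarrow> i2 \<le> tau \<longrightarrow> i1 \<noteq> i2 \<longrightarrow>
            prob_space.expectation M
              (\<lambda>w. d_ch alpha p tau taus u i1 k1 w * d_ch alpha p tau taus u i2 k2 w)
            = - kron (int k1 - int i1 - int k2 + int i2) * alpha i1 * alpha i2 * p i1 * p i2
              * prob_space.expectation M (\<lambda>w. (sig_ext u (int k1 - int i1) w)\<^sup>2))"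
proof -
  interpret prob_space M
    by fact
  define E where "E = sigma_sets (space M) (\<Union>k. {v k -` A \<inter> space M | A. A \<in> sets borel})"
  have "sigma_algebra (space M) E"
    unfolding E_def by (rule sigma_algebra_sigma_sets) auto
  then have "indep_process_events M (count_space UNIV) taus E"
    using assms(1,4) assms(13)[folded E_def]
    by (intro indep_process_events.intro indep_process_events_axioms.intro)
  then interpret D: indep_process_events M "count_space UNIV" taus E .
  obtain xp xk where "sampled_closed_loop (space M) A B C Ak Bk Ck Dk alpha tau taus v u xp xk"
    using closed_loop_imp_sampled_closed_loop[OF assms(14)] by blast
  then interpret L: sampled_closed_loop "space M" A B C Ak Bk Ck Dk alpha tau taus v u xp xk .
  have v_past: "v j \<in> borel_measurable (D.past_filtration k)" for j k
    using assms(7) by (rule D.measurable_past_filtration_if_E)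
      (unfold E_def, rule sigma_sets.Basic, blast)
  have u_past: "u n \<in> borel_measurable (D.past_filtration n)" for n
    using D.filtration_axioms D.measurable_past_filtration_X v_past by (rule L.u_adapted)
  have u_sq: "integrable M (\<lambda>w. (u n w)\<^sup>2)" for n
    using L.abs_u_le_sum_abs_v[of n] measurable_from_subalg[OF D.subalgebra_past_filtration u_past]
      assms(10)
    by (auto intro: integrable_square_if_abs_le_sum)
  interpret delay_channel M taus E tau p u
    using \<open>indep_process_events M (count_space UNIV) taus E\<close> assms(3,5,6) u_past u_sq
    by (intro delay_channel.intro delay_channel_axioms.intro)
  show ?thesis
    using expectation_d_ch_mult by (auto simp: sig_ext_diff kron_def power2_eq_square algebra_simps)
qed

end
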